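(* Let $n\ge 1$ and let $T$ be any binary tree with $n+1$ leaves. Let $B(T)$ be the Young diagram obtained from $T$ by the bookshelf construction, let $D(T)$ be the Dyck path from $(0,0)$ to $(n,n)$ associated with $T$, and let $Y(D(T))$ be the Young diagram formed by the unit squares of the $n\times n$ square lying above the path $D(T)$. Then $B(T)=Y(D(T))$. That is, the triangle of maps (binary trees $\to$ Dyck paths $\to$ Young diagrams, and the bookshelf map binary trees $\to$ Young diagrams) commutes.
   Context: A binary tree is a finite planar rooted tree in which every internal node has exactly two children (a left child and a right child). A Young diagram is a weakly decreasing sequence $\lambda_1\ge\lambda_2\ge\cdots\ge 0$ of integers with finitely many nonzero terms, where $\lambda_i$ is the number of boxes in row $i$; the empty diagram is allowed. A Dyck path from $(0,0)$ to $(n,n)$ is a lattice path of unit up and right steps staying weakly above the diagonal $x=y$. Tree to Dyck path. Label every internal node of $T$ by "left" and every leaf by "down". Read the nodes of $T$ in the preorder that visits a node first, then its right subtree, then its left subtree, omitting the last node read (the leftmost leaf). Starting at $(n,n)$, draw a unit step to the left for every label "left" and a unit step down for every label "down", in the order read. This traces, backwards from $(n,n)$ to $(0,0)$, the Dyck path $D(T)$. Dyck path to Young diagram. $Y(D)$ consists of the unit squares of $[0,n]\times[0,n]$ above (to the upper left of) the path $D$; row $1$ is the top row, and rows are left-justified. Coordinates on the tree. Draw $T$ so that all leaves lie on the bottom level. A node $v$ of $T$ (internal or leaf) has coordinates $(m,k)$, where $m$ is the number of leaves of $T$ strictly to the right of all leaves of the subtree rooted at $v$, and $k$ is the number of leaves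 of $T$ strictly to the left of all leaves of that subtree. Thus the root is at $(0,0)$ and leaves are at $(m,n-m)$, $0\le m\le n$. Edges to right children are descending (they keep the first coordinate constant). Shelves. A maximal descending segment of $T$ with constant first coordinate $m$ runs from a point $(m,k)$ to the leaf $(m,n-m)$. The one with $m=0$ (starting at the root) is called the ceiling. Those of positive length with $m\ge1$ are called shelves. Bookshelf construction. Let the cell $(i,c)$ (row $i\ge1$, column $c\ge1$) be the unit square with corners $(i-1,c-1),(i-1,c),(i,c-1),(i,c)$. For each shelf from $(m,k)$ to $(m,n-m)$, fill in all cells $(i,c)$ with $1\le i\le m$ and $k+1\le c\le n-m$. Take the union of these sets of cells over all shelves, and push the cells of each row to the left so as to eliminate gaps. The result is $B(T)$: its $i$-th row length is the number of filled cells in row $i$. *)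

theory Defs
  imports Main "HOL-Library.Tree"
begin

text \<open>Binary trees carry no labels: \<^const>\<open>Leaf\<close> is a leaf and \<^const>\<open>Node\<close> an internal node
  with its left child first; \<^term>\<open>size1 t\<close> is the number of leaves of \<^term>\<open>t\<close>.\<close>

type_synonym binary_tree = "unit tree"

text \<open>A Young diagram is its sequence of row lengths, indexed from 0: the length of row
  \<^term>\<open>Suc i\<close> is \<^term>\<open>lam i\<close>.  Cells, in contrast, are pairs (row, column) counted from 1.\<close>

definition young_diagram :: "(nat \<Rightarrow> nat) \<Rightarrow> bool" where
  "young_diagram lam \<longleftrightarrow> antimono lam \<and> finite {i. lam i \<noteq> 0}"

definition row_lengths :: "(nat \<times> nat) set \<Rightarrow> nat \<Rightarrow> nat" where
  "row_lengths C i = card {c. (Suc i, c) \<in> C}"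

text \<open>A lattice path is the list of its successive lattice points.\<close>

definition dyck_path :: "nat \<Rightarrow> (int \<times> int) list \<Rightarrow> bool" where
  "dyck_path n p \<longleftrightarrow>
     p \<noteq> [] \<and> hd p = (0, 0) \<and> last p = (int n, int n) \<and>
     successively (\<lambda>(x, y) (x', y'). (x', y') = (x, y + 1) \<or> (x', y') = (x + 1, y)) p \<and>
     (\<forall>(x, y) \<in> set p. x \<le> y)"

datatype label = GoLeft | GoDown

fun reading :: "binary_tree \<Rightarrow> label list" where
  "reading Leaf = [GoDown]"
| "reading (Node l a r) = GoLeft # reading r @ reading l"

fun trace :: "int \<times> int \<Rightarrow> label list \<Rightarrow> (int \<times> int) list" where
  "trace p [] = [p]"
| "trace (x, y) (GoLeft # w) = (x, y) # trace (x - 1, y) w"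
| "trace (x, y) (GoDown # w) = (x, y) # trace (x, y - 1) w"

definition tree_to_dyck :: "binary_tree \<Rightarrow> (int \<times> int) list" where
  "tree_to_dyck t =
     (let n = int (size1 t - 1) in rev (trace (n, n) (butlast (reading t))))"

text \<open>With row 1 on top, the square in row \<open>i\<close> and column \<open>c\<close> is \<open>[c - 1, c] \<times> [n - i, n - i + 1]\<close>;
  it is above the path iff its lower right corner \<open>(c, n - i)\<close> is weakly to the upper left of
  some point of the path.\<close>

definition squares_above :: "nat \<Rightarrow> (int \<times> int) list \<Rightarrow> (nat \<times> nat) set" where
  "squares_above n p =
     {(i, c). 1 \<le> i \<and> i \<le> n \<and> 1 \<le> c \<and> c \<le> n \<and>
              (\<exists>(x, y) \<in> set p. int c \<le> x \<and> y \<le> int n - int i)}"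

definition dyck_to_young :: "nat \<Rightarrow> (int \<times> int) list \<Rightarrow> nat \<Rightarrow> nat" where
  "dyck_to_young n p = row_lengths (squares_above n p)"

text \<open>\<^term>\<open>descending_edges m k t\<close> consists of the edges from an internal node of \<^term>\<open>t\<close> to its
  right child, each node being given by its coordinates in an ambient tree that has \<^term>\<open>m\<close>
  leaves to the right and \<^term>\<open>k\<close> leaves to the left of the subtree \<^term>\<open>t\<close>.  So the root of
  \<^term>\<open>t\<close> has coordinates \<^term>\<open>(m, k)\<close>.\<close>

fun descending_edges :: "nat \<Rightarrow> nat \<Rightarrow> binary_tree \<Rightarrow> ((nat \<times> nat) \<times> (nat \<times> nat)) set" where
  "descending_edges m k Leaf = {}"
| "descending_edges m k (Node l a r) =
     insert ((m, k), (m, k + size1 l))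
       (descending_edges (m + size1 r) k l \<union> descending_edges m (k + size1 l) r)"

text \<open>A shelf is given by its upper end \<open>(m, k)\<close>: a descending edge starts there (positive
  length) and none ends there (maximality).  Its lower end is the leaf \<open>(m, n - m)\<close>.\<close>

definition shelves :: "binary_tree \<Rightarrow> (nat \<times> nat) set" where
  "shelves t =
     {(m, k). 1 \<le> m \<and> (m, k) \<in> Domain (descending_edges 0 0 t) - Range (descending_edges 0 0 t)}"

definition filled_cells :: "binary_tree \<Rightarrow> (nat \<times> nat) set" where
  "filled_cells t =
     (let n = size1 t - 1 in
      \<Union>(m, k) \<in> shelves t. {(i, c). 1 \<le> i \<and> i \<le> m \<and> k + 1 \<le> c \<and> c \<le> n - m})"

definition bookshelf :: "binary_tree \<Rightarrow> nat \<Rightarrow> nat" where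
  "bookshelf t = row_lengths (filled_cells t)"

end

(*
  Both diagrams count internal nodes of T.  A lower end of a descending edge is the right child
  (m, c) of an internal node with first coordinate m, and c numbers the internal nodes in order,
  from 1 to n.  A shelf starting at (m, k) covers exactly the columns c of the internal nodes
  below its upper end, all of which have first coordinate at least m; so the filled columns of
  row i are those of the internal nodes with first coordinate at least i.  An internal node with
  first coordinate m is read just after m leaves, so these are also the nodes read after the i-th
  leaf, and their number is the abscissa of the path when it first reaches height n - i.
*)
theory Submission
  imports Defs
begin

section \<open>Descending edges\<close>

text \<open>\<open>m + k + size1 t\<close> is the number of leaves of the ambient tree and stays the
  same on passing to a child. The last bound is strict because the subtree at the lower end has at
  least one leaf.\<close>

lemma descending_edges_bounds:
  assumes "((m1, k1), (m2, k2)) \<in> descending_edges m k t"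
  shows "m2 = m1 \<and> m \<le> m1 \<and> k \<le> k1 \<and> k1 < k2 \<and> m2 + k2 < m + k + size1 t"
  using assms
proof (induction t arbitrary: m k)
  case (Node l a r)
  then consider "((m1, k1), (m2, k2)) = ((m, k), (m, k + size1 l))"
    | "((m1, k1), (m2, k2)) \<in> descending_edges (m + size1 r) k l"
    | "((m1, k1), (m2, k2)) \<in> descending_edges m (k + size1 l) r"
    by auto
  then show ?case
    by cases (use Node.IH in \<open>fastforce simp: size1_size\<close>)+
qed simp

lemma Range_descending_edges_bounds:
  assumes "(m1, c) \<in> Range (descending_edges m k t)"
  shows "m \<le> m1 \<and> k < c \<and> m1 + c < m + k + size1 t"
proof -
  from assms obtain m0 k0 where "((m0, k0), (m1, c)) \<in> descending_edges m k t" by auto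
  from descending_edges_bounds[OF this] show ?thesis by auto
qed

lemma Range_descending_edges_Node:
  "Range (descending_edges m k (Node l a r)) = insert (m, k + size1 l)
     (Range (descending_edges (m + size1 r) k l) \<union> Range (descending_edges m (k + size1 l) r))"
  by auto

lemma Domain_descending_edges_Node:
  "Domain (descending_edges m k (Node l a r)) = insert (m, k)
     (Domain (descending_edges (m + size1 r) k l) \<union> Domain (descending_edges m (k + size1 l) r))"
  by auto

text \<open>In-order numbering: the root has column \<open>k + size1 l\<close>, which separates the
  columns of the two subtrees.\<close>

lemma column_in_Range_descending_edges:
  assumes "k < c" and "c < k + size1 t"
  shows "\<exists>m1\<ge>m. (m1, c) \<in> Range (descending_edges m k t)"
  using assms
proof (induction t arbitrary: m k)
  case (Node l a r)
  consider "c < k + size1 l" | "c = k + size1 l" | "k + size1 l < c" by linarith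
  then show ?case
  proof cases
    case 1
    then show ?thesis
      using Node.IH(1)[of k "m + size1 r"] Node.prems
      unfolding Range_descending_edges_Node by (meson UnI1 add_leD1 insertI2)
  next
    case 2
    then show ?thesis unfolding Range_descending_edges_Node by auto
  next
    case 3
    then show ?thesis
      using Node.IH(2)[of "k + size1 l" m] Node.prems
      unfolding Range_descending_edges_Node by auto
  qed
qed simp

text \<open>These columns are the in-order range of the subtree rooted at \<open>(m0, k0)\<close>,
  whose nodes all have first coordinate at least \<open>m0\<close>. The induction descends to that
  subtree, where \<open>column_in_Range_descending_edges\<close> applies.\<close>

lemma column_below_Domain_descending_edges:
  assumes "(m0, k0) \<in> Domain (descending_edges m k t)"
    and "k0 < c" and "m0 + c < m + k + size1 t"
  shows "\<exists>m1\<ge>m0. (m1, c) \<in> Range (descending_edges m k t)"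
  using assms
proof (induction t arbitrary: m k)
  case (Node l a r)
  from Node.prems(1) consider "(m0, k0) = (m, k)"
    | "(m0, k0) \<in> Domain (descending_edges (m + size1 r) k l)"
    | "(m0, k0) \<in> Domain (descending_edges m (k + size1 l) r)"
    unfolding Domain_descending_edges_Node by blast
  then show ?case
  proof cases
    case 1
    then show ?thesis
      using column_in_Range_descending_edges[of k c "Node l a r" m] Node.prems by simp
  next
    case 2
    from Node.IH(1)[OF this] Node.prems show ?thesis
      unfolding Range_descending_edges_Node by (auto simp: add_ac)
  next
    case 3
    from Node.IH(2)[OF this] Node.prems show ?thesis
      unfolding Range_descending_edges_Node by (auto simp: add_ac)
  qed
qed simp

text \<open>Climbing a descending edge keeps the first coordinate and lowers the second, so the
  climb stops at a node where no such edge ends.\<close>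

lemma upper_end_of_descending_segment:
  assumes "(m1, c) \<in> Range (descending_edges m k t)"
  shows "\<exists>k0<c. (m1, k0) \<in> Domain (descending_edges m k t) - Range (descending_edges m k t)"
  using assms
proof (induction c rule: less_induct)
  case (less c)
  then obtain m0 k0 where e: "((m0, k0), (m1, c)) \<in> descending_edges m k t" by auto
  with descending_edges_bounds[OF e] have "k0 < c" "(m1, k0) \<in> Domain (descending_edges m k t)"
    by auto
  then show ?case
    using less.IH[of k0] by (meson DiffI less_trans)
qed

section \<open>Row lengths of the bookshelf\<close>

definition node_columns :: "nat \<Rightarrow> nat \<Rightarrow> binary_tree \<Rightarrow> nat \<Rightarrow> nat set" where
  "node_columns m k t i = {c. \<exists>m1\<ge>i. (m1, c) \<in> Range (descending_edges m k t)}"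

lemma node_columns_subset: "node_columns m k t i \<subseteq> {k<..<k + size1 t}"
  using Range_descending_edges_bounds unfolding node_columns_def by fastforce

lemma finite_node_columns: "finite (node_columns m k t i)"
  by (rule finite_subset[OF node_columns_subset]) simp

lemma filled_cells_row:
  assumes "1 \<le> i"
  shows "{c. (i, c) \<in> filled_cells t} = node_columns 0 0 t i"
proof (intro set_eqI iffI)
  fix c assume "c \<in> {c. (i, c) \<in> filled_cells t}"
  then obtain m k where "(m, k) \<in> shelves t" "i \<le> m" "k + 1 \<le> c" "c \<le> size1 t - 1 - m"
    unfolding filled_cells_def Let_def by blast
  then have mk: "(m, k) \<in> Domain (descending_edges 0 0 t)"
      "i \<le> m" "k < c" "c \<le> size1 t - 1 - m"
    unfolding shelves_def by (blast, simp_all)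
  \<comment> \<open>Here \<open>k < c\<close> makes \<open>c\<close> positive, so the truncated
    subtraction is exact.\<close>
  then have "m + c < size1 t" by linarith
  then obtain m1 where "m \<le> m1" "(m1, c) \<in> Range (descending_edges 0 0 t)"
    using column_below_Domain_descending_edges[OF mk(1,3)] by auto
  with mk(2) show "c \<in> node_columns 0 0 t i"
    unfolding node_columns_def by (blast intro: le_trans)
next
  fix c assume "c \<in> node_columns 0 0 t i"
  then obtain m1 where m1: "i \<le> m1" "(m1, c) \<in> Range (descending_edges 0 0 t)"
    unfolding node_columns_def by auto
  obtain k0 where k0: "k0 < c"
      "(m1, k0) \<in> Domain (descending_edges 0 0 t) - Range (descending_edges 0 0 t)"
    using upper_end_of_descending_segment[OF m1(2)] by blast
  \<comment> \<open>As \<open>m1\<close> is at least \<open>i\<close>, hence positive, this segment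
    is not the ceiling.\<close>
  then have "(m1, k0) \<in> shelves t" using m1(1) assms by (simp add: shelves_def)
  moreover have "c \<le> size1 t - 1 - m1"
    using Range_descending_edges_bounds[OF m1(2)] by linarith
  ultimately show "c \<in> {c. (i, c) \<in> filled_cells t}"
    using assms m1(1) k0(1) unfolding filled_cells_def Let_def by force
qed

lemma bookshelf_eq_card: "bookshelf t i = card (node_columns 0 0 t (Suc i))"
  using filled_cells_row[of "Suc i" t] by (simp add: bookshelf_def row_lengths_def)

lemma bookshelf_eq_0:
  assumes "size1 t \<le> Suc i"
  shows "bookshelf t i = 0"
proof -
  have "node_columns 0 0 t (Suc i) = {}"
    using Range_descending_edges_bounds[of _ _ 0 0 t] assms
    unfolding node_columns_def by fastforce
  then show ?thesis by (simp add: bookshelf_eq_card)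
qed

lemma young_diagram_bookshelf: "young_diagram (bookshelf t)"
  unfolding young_diagram_def
proof
  show "antimono (bookshelf t)"
  proof (rule antimonoI)
    fix i j :: nat assume "i \<le> j"
    then have "node_columns 0 0 t (Suc j) \<subseteq> node_columns 0 0 t (Suc i)"
      unfolding node_columns_def by (blast intro: order_trans[OF Suc_le_mono[THEN iffD2]])
    then show "bookshelf t j \<le> bookshelf t i"
      unfolding bookshelf_eq_card by (rule card_mono[OF finite_node_columns])
  qed
  have "{i. bookshelf t i \<noteq> 0} \<subseteq> {..<size1 t}"
    using bookshelf_eq_0[of t] by (metis (mono_tags) lessThan_iff mem_Collect_eq not_less le_SucI subsetI)
  then show "finite {i. bookshelf t i \<noteq> 0}"
    using finite_subset by blast
qed

section \<open>The reading of a tree\<close>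

text \<open>\<open>i\<close> is the number of down labels still to pass; once it is 0, the truncated
  \<open>i - 1\<close> keeps it there.\<close>

fun lefts_after :: "nat \<Rightarrow> label list \<Rightarrow> nat" where
  "lefts_after i [] = 0"
| "lefts_after i (GoLeft # w) = (if i = 0 then 1 else 0) + lefts_after i w"
| "lefts_after i (GoDown # w) = lefts_after (i - 1) w"

lemma lefts_after_append:
  "lefts_after i (u @ w) = lefts_after i u + lefts_after (i - count_list u GoDown) w"
  by (induction i u rule: lefts_after.induct) auto

lemma lefts_after_0: "lefts_after 0 w = count_list w GoLeft"
  by (induction "0 :: nat" w rule: lefts_after.induct) auto

lemma lefts_after_le: "lefts_after i w \<le> count_list w GoLeft"
  by (induction i w rule: lefts_after.induct) auto

lemma count_reading:
  "count_list (reading t) GoLeft = size t" "count_list (reading t) GoDown = size1 t"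
  by (induction t) (auto simp: size1_size)

text \<open>The right subtree is read first, so the left one starts after \<open>size1 r\<close>
  further down labels, matching its offset \<open>m + size1 r\<close>. The root's own label counts
  exactly when \<open>i \<le> m\<close>.\<close>

lemma card_node_columns: "card (node_columns m k t i) = lefts_after (i - m) (reading t)"
proof (induction t arbitrary: m k)
  case Leaf
  then show ?case by (simp add: node_columns_def)
next
  case (Node l a r)
  let ?L = "node_columns (m + size1 r) k l i" and ?R = "node_columns m (k + size1 l) r i"
  let ?S = "if i \<le> m then {k + size1 l} else {}"
  have "node_columns m k (Node l a r) i = ?S \<union> (?L \<union> ?R)"
    unfolding node_columns_def Range_descending_edges_Node by auto
  \<comment> \<open>In-order numbering keeps the columns of left subtree, root and right subtree
    apart, so their cardinalities add.\<close>
  moreover have "?L \<subseteq> {..<k + size1 l}" "?R \<subseteq> {k + size1 l<..}"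
    using node_columns_subset[of "m + size1 r" k l i]
      node_columns_subset[of m "k + size1 l" r i] by auto
  then have "?L \<inter> ?R = {}" "?S \<inter> (?L \<union> ?R) = {}"
    by (fastforce, cases "i \<le> m", auto)
  ultimately have "card (node_columns m k (Node l a r) i) = card ?S + (card ?L + card ?R)"
    by (simp add: card_Un_disjoint finite_node_columns)
  then show ?case
    by (simp add: Node.IH lefts_after_append count_reading)
qed

lemma reading_not_Nil [simp]: "reading t \<noteq> []"
  by (cases t) auto

lemma reading_eq_butlast: "reading t = butlast (reading t) @ [GoDown]"
proof -
  have "last (reading t) = GoDown"
    by (induction t) auto
  then show ?thesis by (metis append_butlast_last_id reading_not_Nil)
qed

lemma count_butlast_reading:
  "count_list (butlast (reading t)) GoLeft = size t"
  "count_list (butlast (reading t)) GoDown = size t"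
  using arg_cong[OF reading_eq_butlast, of "\<lambda>w. count_list w GoLeft" t]
    arg_cong[OF reading_eq_butlast, of "\<lambda>w. count_list w GoDown" t]
  by (simp_all add: count_reading size1_size)

lemma lefts_after_butlast_reading:
  "lefts_after i (butlast (reading t)) = lefts_after i (reading t)"
  by (subst (2) reading_eq_butlast) (cases i; simp add: lefts_after_append)

section \<open>The Dyck path\<close>

lemma trace_not_Nil [simp]: "trace p w \<noteq> []"
  by (induction p w rule: trace.induct) auto

lemma hd_trace: "hd (trace p w) = p"
  by (induction p w rule: trace.induct) auto

lemma last_trace:
  "last (trace (x, y) w) = (x - int (count_list w GoLeft), y - int (count_list w GoDown))"
  by (induction "(x, y)" w arbitrary: x y rule: trace.induct) auto

text \<open>The trace runs backwards along the Dyck path, so the step relation appears with its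
  arguments exchanged.\<close>

lemma successively_trace:
  "successively (\<lambda>(x', y') (x, y). (x', y') = (x, y + 1) \<or> (x', y') = (x + 1, y)) (trace p w)"
  by (induction p w rule: trace.induct) (auto simp: successively_Cons hd_trace)

text \<open>A full reading lowers \<open>y - x\<close> by one. The root's left step first raises it
  by one, so after the right subtree the left one again starts weakly above the diagonal. The suffix
  \<open>w\<close> allows for what is read later.\<close>

lemma trace_reading_append_above_diagonal:
  assumes "x \<le> y"
    and "\<forall>(x', y') \<in> set (trace (x - int (size t), y - int (size1 t)) w). x' \<le> y'"
  shows "\<forall>(x', y') \<in> set (trace (x, y) (reading t @ w)). x' \<le> y'"
  using assms
proof (induction t arbitrary: x y w)
  case (Node l a r)
  have "\<forall>(x', y') \<in> set (trace (x - 1 - int (size r), y - int (size1 r)) (reading l @ w)). x' \<le> y'"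
    by (rule Node.IH(1)) (use Node.prems in \<open>auto simp: size1_size algebra_simps\<close>)
  then have "\<forall>(x', y') \<in> set (trace (x - 1, y) (reading r @ reading l @ w)). x' \<le> y'"
    by (intro Node.IH(2)) (use Node.prems in auto)
  then show ?case using Node.prems(1) by simp
qed simp

lemma trace_butlast_reading_above_diagonal:
  assumes "x \<le> y"
  shows "\<forall>(x', y') \<in> set (trace (x, y) (butlast (reading t))). x' \<le> y'"
  using assms
proof (induction t arbitrary: x y)
  case (Node l a r)
  have "butlast (reading (Node l a r)) = GoLeft # reading r @ butlast (reading l)"
    by (simp add: butlast_append)
  moreover have "\<forall>(x', y') \<in> set (trace (x - 1, y) (reading r @ butlast (reading l))). x' \<le> y'"
    by (intro trace_reading_append_above_diagonal Node.IH(1))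
      (use Node.prems in \<open>auto simp: size1_size\<close>)
  ultimately show ?case using Node.prems by simp
qed simp

lemma dyck_path_tree_to_dyck: "dyck_path (size t) (tree_to_dyck t)"
proof -
  let ?n = "int (size t)"
  let ?p = "trace (?n, ?n) (butlast (reading t))"
  have "last ?p = (0, 0)" by (simp add: last_trace count_butlast_reading)
  moreover have "successively (\<lambda>(x, y) (x', y'). (x', y') = (x, y + 1) \<or> (x', y') = (x + 1, y)) (rev ?p)"
    unfolding successively_rev
    by (rule successively_mono[OF successively_trace]) auto
  ultimately show ?thesis
    using trace_butlast_reading_above_diagonal[of ?n ?n t]
    by (simp add: dyck_path_def tree_to_dyck_def Let_def size1_size hd_rev last_rev hd_trace)
qed

lemma trace_abscissa_le: "(x', y') \<in> set (trace (x, y) w) \<Longrightarrow> x' \<le> x"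
  by (induction "(x, y)" w arbitrary: x y rule: trace.induct) force+

text \<open>Abscissas never increase along the trace, so the rightmost point at least
  \<open>i\<close> lower comes just after the \<open>i\<close>-th down label (the start if
  \<open>i\<close> is 0). From there \<open>lefts_after i w\<close> left steps lead to the
  end.\<close>

lemma trace_reaches_below_iff:
  "(\<exists>(x', y') \<in> set (trace (x, y) w). c \<le> x' \<and> y' \<le> y - int i) \<longleftrightarrow>
     i \<le> count_list w GoDown \<and> c \<le> x - int (count_list w GoLeft) + int (lefts_after i w)"
proof (induction "(x, y)" w arbitrary: x y i rule: trace.induct)
  case (1 x y)
  then show ?case by auto
next
  case (2 x y w)
  show ?case
  proof (cases i)
    case 0
    then show ?thesis using 2[of 0] by (auto simp: lefts_after_0)
  next
    case (Suc j)
    then show ?thesis using 2[of i] by auto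
  qed
next
  case (3 x y w)
  show ?case
  proof (cases i)
    case 0
    then show ?thesis using trace_abscissa_le[of _ _ x "y - 1" w] by (force simp: lefts_after_0)
  next
    case (Suc j)
    then show ?thesis using 3[of j] by (auto simp: algebra_simps)
  qed
qed

lemma dyck_to_young_tree_to_dyck:
  "dyck_to_young (size t) (tree_to_dyck t) i = (if i < size t then lefts_after (Suc i) (reading t) else 0)"
proof (cases "i < size t")
  case True
  let ?w = "butlast (reading t)"
  \<comment> \<open>Places the whole row inside the square.\<close>
  have "lefts_after (Suc i) (reading t) \<le> size t"
    using lefts_after_le[of "Suc i" "reading t"] by (simp add: count_reading)
  \<comment> \<open>The trace ends at abscissa 0, so the bound on \<open>c\<close> is
    \<open>lefts_after\<close> itself.\<close>
  moreover have "(\<exists>(x, y) \<in> set (trace (int (size t), int (size t)) ?w).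
      int c \<le> x \<and> y \<le> int (size t) - int (Suc i)) \<longleftrightarrow> c \<le> lefts_after (Suc i) (reading t)" for c
    unfolding trace_reaches_below_iff
    using True by (simp add: count_butlast_reading lefts_after_butlast_reading)
  ultimately have "{c. (Suc i, c) \<in> squares_above (size t) (tree_to_dyck t)}
      = {1..lefts_after (Suc i) (reading t)}"
    using True unfolding squares_above_def tree_to_dyck_def
    by (auto simp: size1_size Let_def simp del: of_nat_Suc)
  then show ?thesis using True by (simp add: dyck_to_young_def row_lengths_def)
next
  case False
  then show ?thesis by (simp add: dyck_to_young_def row_lengths_def squares_above_def)
qed

theorem mainTheorem2:
  fixes n :: nat and T :: binary_tree
  assumes "n \<ge> 1" and "size1 T = n + 1"
  shows "dyck_path n (tree_to_dyck T) \<and> young_diagram (bookshelf T) \<and>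
    bookshelf T = dyck_to_young n (tree_to_dyck T)"
proof (intro conjI)
  have n: "n = size T" using assms(2) by (simp add: size1_size)
  show "dyck_path n (tree_to_dyck T)" unfolding n by (rule dyck_path_tree_to_dyck)
  show "young_diagram (bookshelf T)" by (rule young_diagram_bookshelf)
  show "bookshelf T = dyck_to_young n (tree_to_dyck T)"
    unfolding n
  proof
    fix i
    show "bookshelf T i = dyck_to_young (size T) (tree_to_dyck T) i"
    proof (cases "i < size T")
      case True
      then show ?thesis
        by (simp add: dyck_to_young_tree_to_dyck bookshelf_eq_card card_node_columns)
    next
      case False
      then show ?thesis
        by (simp add: dyck_to_young_tree_to_dyck bookshelf_eq_0 size1_size)
    qed
  qed
qed

end
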